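(* Let $O^h_n$ be the ortho-chain (hexagonal) graph of order $n$. Then: (i) for every $n\geq 2$ and $k\geq 1$, if $n=2k$, then $$ABC_{GG}(O^h_n)=4\left(\sum_{i=1}^{k}\sqrt{\frac{10k-1}{(10k-5i+3)(5i-2)}}\right)+8k\sqrt{\frac{10k-1}{30k-6}},$$ and if $n=2k+1$, then $$ABC_{GG}(O^h_n)=4\left(\sum_{i=1}^{k}\sqrt{\frac{10k+4}{(10k-5i+8)(5i-2)}}\right)+(8k+4)\sqrt{\frac{10k+4}{30k+9}}+\frac{2\sqrt{10k+4}}{5k+3};$$ (ii) for every $n\geq 2$, $$ABC(O^h_n)=\frac{5n+2}{\sqrt{2}}+\frac{(n-2)\sqrt{6}}{4}.$$
   Context: For a finite simple graph $G$, $ABC(G)=\sum_{uv\in E(G)}\sqrt{\frac{d_u+d_v-2}{d_ud_v}}$, where $d_u$ is the degree of $u$ in $G$. For an edge $uv$ of $G$, $n_u(uv,G)$ is the number of vertices of $G$ strictly closer to $u$ than to $v$, and $n_v(uv,G)$ is defined analogously; equidistant vertices are not counted. $ABC_{GG}(G)=\sum_{uv\in E(G)}\sqrt{\frac{n_u(uv,G)+n_v(uv,G)-2}{n_u(uv,G)n_v(uv,G)}}$. The ortho-chain graph $O^h_n$ of order $n$ consists of $n$ hexagons glued in a chain with adjacent contact vertices: take $n$ disjoint 6-cycles, choose in the $i$-th one two adjacent vertices $x_i,y_i$, and identify $y_i$ with $x_{i+1}$ for $i=1,\ldots,n-1$. *)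

theory Defs
  imports Complex_Main "HOL-Library.Extended_Nat"
begin

record 'a ugraph =
  verts :: "'a set"
  edges :: "'a set set"

definition fin_simple_graph :: "'a ugraph \<Rightarrow> bool" where
  "fin_simple_graph G \<longleftrightarrow> finite (verts G) \<and> (\<forall>e\<in>edges G. e \<subseteq> verts G \<and> card e = 2)"

definition degree :: "'a ugraph \<Rightarrow> 'a \<Rightarrow> nat" where
  "degree G u = card {e \<in> edges G. u \<in> e}"

definition walks :: "'a ugraph \<Rightarrow> 'a \<Rightarrow> 'a \<Rightarrow> 'a list set" where
  "walks G u v = {p. p \<noteq> [] \<and> set p \<subseteq> verts G \<and> hd p = u \<and> last p = v \<and>
                     successively (\<lambda>a b. {a, b} \<in> edges G) p}"

text \<open>A walk is given by its list of vertices, hence its length is one less than that of the list.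
  The distance of vertices in different components is \<open>\<infinity>\<close>.\<close>

definition distance :: "'a ugraph \<Rightarrow> 'a \<Rightarrow> 'a \<Rightarrow> enat" where
  "distance G u v = (INF p\<in>walks G u v. enat (length p - 1))"

text \<open>For an edge \<open>e = {u, v}\<close>, \<open>n_closer G u e\<close> is \<open>n\<^sub>u(uv, G)\<close>: the variable \<open>v\<close>
  below ranges over the singleton consisting of the other endpoint.\<close>

definition n_closer :: "'a ugraph \<Rightarrow> 'a \<Rightarrow> 'a set \<Rightarrow> nat" where
  "n_closer G u e = card {w \<in> verts G. \<forall>v\<in>e - {u}. distance G w u < distance G w v}"

text \<open>Both indices are meant for finite simple graphs. Edges are unordered pairs, so the sums and
  products over \<open>u \<in> e\<close> are the two-term expressions in the endpoints of \<open>e\<close>.\<close>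

definition ABC :: "'a ugraph \<Rightarrow> real" where
  "ABC G = (\<Sum>e\<in>edges G.
     sqrt (((\<Sum>u\<in>e. real (degree G u)) - 2) / (\<Prod>u\<in>e. real (degree G u))))"

definition ABC_GG :: "'a ugraph \<Rightarrow> real" where
  "ABC_GG G = (\<Sum>e\<in>edges G.
     sqrt (((\<Sum>u\<in>e. real (n_closer G u e)) - 2) / (\<Prod>u\<in>e. real (n_closer G u e))))"

text \<open>The \<open>i\<close>-th of the \<open>n\<close> disjoint 6-cycles has the vertices \<open>(i, 0), \<dots>, (i, 5)\<close>
  in cyclic order.\<close>

definition disjoint_hexagons :: "nat \<Rightarrow> (nat \<times> nat) ugraph" where
  "disjoint_hexagons n =
     \<lparr>verts = {1..n} \<times> {0..<6},
      edges = {{(i, j), (i, (j + 1) mod 6)} | i j. i \<in> {1..n} \<and> j \<in> {0..<6}}\<rparr>"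

text \<open>Identify vertices that have the same image under \<open>f\<close>.\<close>

definition identify :: "('a \<Rightarrow> 'b) \<Rightarrow> 'a ugraph \<Rightarrow> 'b ugraph" where
  "identify f G = \<lparr>verts = f ` verts G, edges = (\<lambda>e. f ` e) ` edges G\<rparr>"

text \<open>In the \<open>i\<close>-th hexagon the chosen adjacent vertices are \<open>x\<^sub>i = (i, 0)\<close> and
  \<open>y\<^sub>i = (i, 1)\<close>; since the symmetries of the hexagon act transitively on ordered pairs of
  adjacent vertices, any other choice gives an isomorphic graph. The gluing map sends \<open>y\<^sub>i\<close> to
  \<open>x\<^sub>i\<^sub>+\<^sub>1\<close> for \<open>i < n\<close> and fixes all other vertices.\<close>

definition glue :: "nat \<Rightarrow> nat \<times> nat \<Rightarrow> nat \<times> nat" where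
  "glue n = (\<lambda>(i, j). if j = 1 \<and> i < n then (i + 1, 0) else (i, j))"

definition ortho_chain :: "nat \<Rightarrow> (nat \<times> nat) ugraph" where
  "ortho_chain n = identify (glue n) (disjoint_hexagons n)"

text \<open>The gluing creates no loops.\<close>

lemma fin_simple_graph_ortho_chain: "fin_simple_graph (ortho_chain n)"
proof -
  have "e \<subseteq> verts (ortho_chain n) \<and> card e = 2" if e: "e \<in> edges (ortho_chain n)" for e
  proof -
    from e obtain i j where ij: "i \<in> {1..n}" "j < 6"
      and e_eq: "e = {glue n (i, j), glue n (i, (j + 1) mod 6)}"
      by (auto simp: ortho_chain_def identify_def disjoint_hexagons_def)
    have "j = 0 \<or> j = 1 \<or> j = 2 \<or> j = 3 \<or> j = 4 \<or> j = 5"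
      using ij by linarith
    then have "glue n (i, j) \<noteq> glue n (i, (j + 1) mod 6)"
      by (elim disjE) (simp_all add: glue_def)
    moreover have "e \<subseteq> verts (ortho_chain n)"
      using ij unfolding e_eq ortho_chain_def identify_def disjoint_hexagons_def by auto
    ultimately show ?thesis
      by (simp add: e_eq)
  qed
  then show ?thesis
    by (simp add: fin_simple_graph_def ortho_chain_def identify_def disjoint_hexagons_def)
qed

end

theory Submission
  imports Defs
begin

text \<open>
  The \<open>n\<close> hexagons of the ortho-chain meet in cut vertices only, so for an edge of the \<open>i\<close>-th
  hexagon all that matters about a vertex \<open>w\<close> is the corner of that hexagon through which \<open>w\<close> is
  reached: the rest of the chain hangs on the corners 0 and 1. This corner is \<open>hex_proj i w\<close>.
  Three consecutive corners of a hexagon are nearer to one end of a given edge, the opposite three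
  to the other end; hence \<open>n\<^sub>u\<close> and \<open>n\<^sub>v\<close> are the numbers of vertices projected to the two
  triples, where corner 0 counts \<open>5 * i - 4\<close> times, corner 1 counts \<open>5 * (n - i) + 1\<close> times, and
  the others count once. If the edge joins corners 0 and 1 or is opposite to that edge, the two
  numbers are \<open>5 * i - 2\<close> and \<open>5 * (n - i) + 3\<close>; for the other four edges both contact corners lie
  on the same side and the numbers are \<open>5 * n - 2\<close> and \<open>3\<close>. In all cases they add up to
  \<open>5 * n + 1\<close>. This yields \<open>ABC_GG_ortho_chain\<close>; the two formulas by parity of \<open>n\<close> arise because
  the summand is invariant under \<open>i \<mapsto> n + 1 - i\<close>, a middle term remaining when \<open>n\<close> is odd.

  Distances are not computed. The statement about nearness comes from a folding argument
  (\<open>closer_of_fold\<close>): reflecting the hexagon in the axis that exchanges the ends of the edge, and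
  collapsing everything attached to the reflected half, gives a map that fixes one side, sends
  edges to edges or to single vertices, and contracts the two edges that cross the axis. A walk
  from a vertex of the fixed side to the far end of the edge crosses the axis, so its image is a
  strictly shorter walk to the near end.

  For \<open>ABC\<close> only the degrees matter: the \<open>n - 1\<close> vertices in which two hexagons are glued have
  degree 4 and all others have degree 2. An edge with an end of degree 2 contributes \<open>1 / sqrt 2\<close>,
  whatever the other degree; the \<open>n - 2\<close> edges between two vertices of degree 4 contribute
  \<open>sqrt 6 / 4\<close> each.
\<close>

section \<open>Foldings and distances\<close>

text \<open>The image of a walk under \<open>\<phi>\<close> is a walk once repetitions are removed. A walk that starts at a
  fixed vertex and ends at a vertex that is not fixed uses an edge from a fixed to a moved vertex;
  \<open>contr\<close> makes the image stand still there, which saves a step.\<close>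

lemma walk_image_under_fold:
  assumes hom: "\<And>a b. {a, b} \<in> edges G \<Longrightarrow> \<phi> a = \<phi> b \<or> {\<phi> a, \<phi> b} \<in> edges G"
    and vert: "\<phi> ` verts G \<subseteq> verts G"
    and contr: "\<And>a b. {a, b} \<in> edges G \<Longrightarrow> \<phi> a = a \<Longrightarrow> \<phi> b \<noteq> b \<Longrightarrow> \<phi> b = a"
    and "p \<in> walks G x y"
  shows "\<exists>q\<in>walks G (\<phi> x) (\<phi> y). length q + (if \<phi> x = x \<and> \<phi> y \<noteq> y then 1 else 0) \<le> length p"
  using \<open>p \<in> walks G x y\<close>
proof (induction p arbitrary: x)
  case Nil
  then show ?case by (simp add: walks_def)
next
  case (Cons z p)
  show ?case
  proof (cases p)
    case Nil
    then have "x = y" "[\<phi> x] \<in> walks G (\<phi> x) (\<phi> y)"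
      using Cons.prems vert by (auto simp: walks_def)
    then show ?thesis using Nil by (intro bexI[of _ "[\<phi> x]"]) auto
  next
    case (Cons x' p')
    have [simp]: "z = x" and edge: "{x, x'} \<in> edges G" and "x \<in> verts G"
      and tail: "p \<in> walks G x' y"
      using Cons.prems Cons by (auto simp: walks_def)
    obtain q where q: "q \<in> walks G (\<phi> x') (\<phi> y)"
      and len: "length q + (if \<phi> x' = x' \<and> \<phi> y \<noteq> y then 1 else 0) \<le> length p"
      using Cons.IH[OF tail] by blast
    show ?thesis
    proof (cases "\<phi> x = \<phi> x'")
      case True
      then show ?thesis using q len by (intro bexI[of _ q]) (auto split: if_splits)
    next
      case False
      have "\<phi> x # q \<in> walks G (\<phi> x) (\<phi> y)"
        using q hom[OF edge] False \<open>x \<in> verts G\<close> vert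
        by (cases q) (auto simp: walks_def)
      moreover have "\<phi> x' = x'" if "\<phi> x = x"
        using contr[OF edge that] False that by auto
      ultimately show ?thesis using len by (intro bexI[of _ "\<phi> x # q"]) (auto split: if_splits)
    qed
  qed
qed

text \<open>The lengths of walks are natural numbers, so the infimum over a nonempty set is a minimum.\<close>

lemma distance_attained:
  assumes "walks G x y \<noteq> {}"
  obtains p where "p \<in> walks G x y" "distance G x y = enat (length p - 1)"
proof -
  obtain p where p: "p \<in> walks G x y" "\<And>q. q \<in> walks G x y \<Longrightarrow> length p \<le> length q"
    using ex_has_least_nat[of "\<lambda>p. p \<in> walks G x y" _ length] assms by blast
  have "distance G x y = enat (length p - 1)"
    unfolding distance_def
    by (intro antisym INF_lower INF_greatest p(1)) (auto intro: diff_le_mono p(2))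
  with p(1) that show thesis by blast
qed

text \<open>Existence of a walk from \<open>w\<close> to \<open>v\<close> makes the inequality strict: without it, both distances could
  be infinite.\<close>

lemma closer_of_fold:
  assumes hom: "\<And>a b. {a, b} \<in> edges G \<Longrightarrow> \<phi> a = \<phi> b \<or> {\<phi> a, \<phi> b} \<in> edges G"
    and vert: "\<phi> ` verts G \<subseteq> verts G"
    and contr: "\<And>a b. {a, b} \<in> edges G \<Longrightarrow> \<phi> a = a \<Longrightarrow> \<phi> b \<noteq> b \<Longrightarrow> \<phi> b = a"
    and "\<phi> w = w" "\<phi> v = u" "u \<noteq> v" "walks G w v \<noteq> {}"
  shows "distance G w u < distance G w v"
proof -
  obtain p where p: "p \<in> walks G w v" "distance G w v = enat (length p - 1)"
    using distance_attained \<open>walks G w v \<noteq> {}\<close> by metis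
  obtain q where q: "q \<in> walks G w u" "length q + 1 \<le> length p"
    using walk_image_under_fold[of G \<phi>, OF hom vert contr p(1)] assms(4-6) by auto
  have "distance G w u \<le> enat (length q - 1)"
    unfolding distance_def using q(1) by (rule INF_lower)
  also have "\<dots> < distance G w v"
    using q by (cases q) (auto simp: p(2) walks_def)
  finally show ?thesis .
qed

lemma n_closer_eq_card:
  assumes "u \<noteq> v" "S \<subseteq> verts G"
    and "\<And>w. w \<in> S \<Longrightarrow> distance G w u < distance G w v"
    and "\<And>w. w \<in> verts G - S \<Longrightarrow> distance G w v < distance G w u"
  shows "n_closer G u {u, v} = card S"
proof -
  have "{u, v} - {u} = {v}" using \<open>u \<noteq> v\<close> by auto
  then have "{w \<in> verts G. \<forall>x\<in>{u, v} - {u}. distance G w u < distance G w x} = S"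
    using assms(2-4) by (auto dest: order.asym)
  then show ?thesis by (simp add: n_closer_def)
qed

lemma walk_of_rtrancl:
  assumes "fin_simple_graph G" "x \<in> verts G" "(x, y) \<in> {(a, b). {a, b} \<in> edges G}\<^sup>*"
  shows "walks G x y \<noteq> {}"
  using assms(3)
proof (induction rule: rtrancl_induct)
  case base
  have "[x] \<in> walks G x x" using assms(2) by (simp add: walks_def)
  then show ?case by blast
next
  case (step y z)
  then obtain p where "p \<in> walks G x y" by blast
  then have "p @ [z] \<in> walks G x z"
    using step.hyps(2) assms(1) 
    by (auto simp: walks_def fin_simple_graph_def successively_append_iff)
  then show ?case by blast
qed

section \<open>Vertices, edges and connectedness of the ortho-chain\<close>

definition hex_edge :: "nat \<Rightarrow> nat \<times> nat \<Rightarrow> (nat \<times> nat) set" where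
  "hex_edge n = (\<lambda>(i, j). {glue n (i, j), glue n (i, (j + 1) mod 6)})"

lemma less_six_cases:
  assumes "(j::nat) < 6"
  obtains "j = 0" | "j = 1" | "j = 2" | "j = 3" | "j = 4" | "j = 5"
  using assms by linarith

lemma edges_ortho_chain: "edges (ortho_chain n) = hex_edge n ` ({1..n} \<times> {..<6})"
proof -
  have "edges (disjoint_hexagons n) = (\<lambda>(i, j). {(i, j), (i, (j + 1) mod 6)}) ` ({1..n} \<times> {..<6})"
    unfolding disjoint_hexagons_def by (force simp: image_iff)
  then show ?thesis
    by (auto simp: ortho_chain_def identify_def hex_edge_def image_image split_def)
qed

lemma verts_ortho_chain:
  "verts (ortho_chain n) = {(i, j). 1 \<le> i \<and> i \<le> n \<and> j < 6 \<and> (j = 1 \<longrightarrow> i = n)}" (is "_ = ?V")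
proof
  show "verts (ortho_chain n) \<subseteq> ?V"
    by (auto simp: ortho_chain_def identify_def disjoint_hexagons_def glue_def split: if_splits)
  show "?V \<subseteq> verts (ortho_chain n)"
  proof
    fix w assume "w \<in> ?V"
    then have "w = glue n w" "w \<in> {1..n} \<times> {0..<6}"
      by (auto simp: glue_def)
    then show "w \<in> verts (ortho_chain n)"
      unfolding ortho_chain_def identify_def disjoint_hexagons_def by auto
  qed
qed

lemma glue_in_verts: "i \<in> {1..n} \<Longrightarrow> j < 6 \<Longrightarrow> glue n (i, j) \<in> verts (ortho_chain n)"
  by (auto simp: verts_ortho_chain glue_def)

text \<open>No edge is lost in the gluing, because two hexagons share at most one vertex. Sums over the edges
  therefore become double sums over hexagons and positions.\<close>

lemma inj_on_hex_edge: "inj_on (hex_edge n) ({1..n} \<times> {..<6})"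
proof (rule inj_onI, clarify)
  fix i j i' j' assume ij: "i \<in> {1..n}" "j < 6" "i' \<in> {1..n}" "j' < 6"
    and eq: "hex_edge n (i, j) = hex_edge n (i', j')"
  from ij(2) show "i = i' \<and> j = j'"
    by (cases rule: less_six_cases; use ij(4) in \<open>cases rule: less_six_cases;
          use ij eq in \<open>auto simp: hex_edge_def glue_def doubleton_eq_iff split: if_splits\<close>\<close>)
qed

text \<open>Each vertex is reached from \<open>glue n (1, 0)\<close> by passing from hexagon to hexagon along the edges
  between contact vertices and then going round the last hexagon.\<close>

lemma ortho_chain_connected:
  assumes "x \<in> verts (ortho_chain n)" "y \<in> verts (ortho_chain n)"
  shows "walks (ortho_chain n) x y \<noteq> {}"
proof -
  let ?R = "{(a, b). {a, b} \<in> edges (ortho_chain n)}"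
  have sym: "sym (?R\<^sup>*)"
    by (intro sym_rtrancl) (auto simp: sym_def insert_commute)
  have step: "(glue n (i, j), glue n (i, (j + 1) mod 6)) \<in> ?R" if "i \<in> {1..n}" "j < 6" for i j
    using that by (force simp: edges_ortho_chain hex_edge_def)
  have row: "(glue n (i, 0), glue n (i, j)) \<in> ?R\<^sup>*" if "i \<in> {1..n}" "j < 6" for i j
    using that(2)
  proof (induction j)
    case (Suc j)
    then show ?case using step[OF that(1), of j] by (auto intro: rtrancl_into_rtrancl)
  qed simp
  have column: "(glue n (1, 0), glue n (i, 0)) \<in> ?R\<^sup>*" if "1 \<le> i" "i \<le> n" for i
    using that
  proof (induction i rule: dec_induct)
    case (step i)
    then have "glue n (i, 1) = glue n (Suc i, 0)" by (simp add: glue_def)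
    then show ?case using step row[of i 1] by (auto intro: rtrancl_trans)
  qed simp
  have root: "(glue n (1, 0), z) \<in> ?R\<^sup>*" if "z \<in> verts (ortho_chain n)" for z
  proof -
    from that obtain i j where "z = glue n (i, j)" "i \<in> {1..n}" "j < 6"
      by (auto simp: ortho_chain_def identify_def disjoint_hexagons_def)
    then show ?thesis using column[of i] row[of i j] by (auto intro: rtrancl_trans)
  qed
  have "(x, y) \<in> ?R\<^sup>*"
    using symD[OF sym root[OF assms(1)]] root[OF assms(2)] by (rule rtrancl_trans)
  then show ?thesis by (intro walk_of_rtrancl fin_simple_graph_ortho_chain assms)
qed

section \<open>Projection onto a hexagon\<close>

text \<open>The corner of the \<open>i\<close>-th hexagon that is nearest to a vertex: the earlier hexagons hang on corner 0,
  the later ones on corner 1. The contact vertex shared with the next hexagon is represented as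
  \<open>(i + 1, 0)\<close> and is rightly sent to 1.\<close>

definition hex_proj :: "nat \<Rightarrow> nat \<times> nat \<Rightarrow> nat" where
  "hex_proj i = (\<lambda>(a, b). if a = i then b else if a < i then 0 else 1)"

lemma hex_proj_glue:
  "hex_proj i (glue n (a, b)) = (if a = i then b else if a < i then 0 else 1)"
  by (auto simp: hex_proj_def glue_def)

lemma hex_proj_less: "w \<in> verts (ortho_chain n) \<Longrightarrow> hex_proj i w < 6"
  by (auto simp: verts_ortho_chain hex_proj_def)

text \<open>The projection collapses every edge outside the \<open>i\<close>-th hexagon, which makes the fold below a map
  that can be checked on the six edges of a single hexagon.\<close>

lemma edge_proj_cases:
  assumes "{a, b} \<in> edges (ortho_chain n)"
  obtains "hex_proj i a = hex_proj i b"
  | x where "x < 6" "i \<in> {1..n}" "a = glue n (i, x)" "b = glue n (i, (x + 1) mod 6)"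
  | x where "x < 6" "i \<in> {1..n}" "b = glue n (i, x)" "a = glue n (i, (x + 1) mod 6)"
proof -
  obtain k x where "k \<in> {1..n}" "x < 6" 
    and "a = glue n (k, x) \<and> b = glue n (k, (x + 1) mod 6) \<or>
         b = glue n (k, x) \<and> a = glue n (k, (x + 1) mod 6)"
    using assms by (auto simp: edges_ortho_chain hex_edge_def doubleton_eq_iff)
  then show thesis
    using that by (cases "k = i") (auto simp: hex_proj_glue)
qed

section \<open>The two sides of an edge\<close>

text \<open>The reflection that exchanges corners \<open>j\<close> and \<open>j + 1\<close> is \<open>x \<mapsto> 2 * j + 1 - x\<close> modulo 6; adding 6
  keeps the truncated subtraction exact for \<open>x < 6\<close>.\<close>

definition hex_reflect :: "nat \<Rightarrow> nat \<Rightarrow> nat" where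
  "hex_reflect j x = (2 * j + 7 - x) mod 6"

text \<open>The half of the hexagon on the side of \<open>j\<close>, for the edge between corners \<open>j\<close> and \<open>j + 1\<close>.\<close>

definition hex_side :: "nat \<Rightarrow> nat set" where
  "hex_side j = {j, (j + 5) mod 6, (j + 4) mod 6}"

lemma hex_reflect_side:
  assumes "j < 6" "x < 6"
  shows "hex_reflect j x \<in> hex_side j \<longleftrightarrow> x \<notin> hex_side j"
    and "(x \<in> hex_side j) \<noteq> ((x + 1) mod 6 \<in> hex_side j) \<Longrightarrow> hex_reflect j x = (x + 1) mod 6"
  using assms(1)
  by (cases rule: less_six_cases; use assms(2) in \<open>cases rule: less_six_cases;
      simp add: hex_reflect_def hex_side_def\<close>)+

lemma hex_reflect:
  assumes "j < 6" "x < 6"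
  shows "hex_reflect j (hex_reflect j x) = x" 
    and "(hex_reflect j ((x + 1) mod 6) + 1) mod 6 = hex_reflect j x"
  using assms(1)
  by (cases rule: less_six_cases; use assms(2) in \<open>cases rule: less_six_cases;
      simp add: hex_reflect_def\<close>)+

lemma hex_reflect_less: "hex_reflect j x < 6"
  by (simp add: hex_reflect_def)

text \<open>The set \<open>A\<close> stands for either half of the hexagon, so that this covers both ends of the edge. Both
  \<open>flip\<close> and \<open>cut\<close> pass to the complement of \<open>A\<close>.\<close>

lemma closer_on_side:
  assumes i: "i \<in> {1..n}" and j: "j < 6" and "x < 6" "x \<notin> A"
    and flip: "\<And>x. x < 6 \<Longrightarrow> hex_reflect j x \<in> A \<longleftrightarrow> x \<notin> A"
    and cut: "\<And>x. x < 6 \<Longrightarrow> (x \<in> A) \<noteq> ((x + 1) mod 6 \<in> A) \<Longrightarrow> hex_reflect j x = (x + 1) mod 6"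
    and w: "w \<in> verts (ortho_chain n)" "hex_proj i w \<in> A"
  shows "distance (ortho_chain n) w (glue n (i, hex_reflect j x))
       < distance (ortho_chain n) w (glue n (i, x))"
proof -
  \<comment> \<open>Vertices projected outside \<open>A\<close> go to the mirror image of their projection, which also
    collapses the part of the chain that hangs on the reflected half.\<close>
  define \<phi> where "\<phi> w = (if hex_proj i w \<in> A then w else glue n (i, hex_reflect j (hex_proj i w)))"
    for w
  have glue_\<phi>: "\<phi> (glue n (i, x)) = glue n (i, if x \<in> A then x else hex_reflect j x)" for x
    by (simp add: \<phi>_def hex_proj_glue)
  have fixed: "\<phi> w = w \<longleftrightarrow> hex_proj i w \<in> A" if "w \<in> verts (ortho_chain n)" for w
    using flip[OF hex_proj_less[OF that]] that
    by (auto simp: \<phi>_def) (metis hex_proj_glue)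
  have edge: "{glue n (i, x), glue n (i, (x + 1) mod 6)} \<in> edges (ortho_chain n)" if "x < 6" for x
    using that i by (force simp: edges_ortho_chain hex_edge_def)
  have in_verts: "a \<in> verts (ortho_chain n)" "b \<in> verts (ortho_chain n)"
    if "{a, b} \<in> edges (ortho_chain n)" for a b
    using that fin_simple_graph_ortho_chain[of n] by (auto simp: fin_simple_graph_def)
  \<comment> \<open>An edge inside the reflected half is mapped to its mirror image; an edge across the axis is
    contracted, since its ends are mirror images of each other.\<close>
  have hex_edge: "\<phi> (glue n (i, x)) = \<phi> (glue n (i, (x + 1) mod 6)) \<or>
      {\<phi> (glue n (i, x)), \<phi> (glue n (i, (x + 1) mod 6))} \<in> edges (ortho_chain n)" if "x < 6" for x
  proof (cases "x \<in> A \<longleftrightarrow> (x + 1) mod 6 \<in> A")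
    case True
    then show ?thesis
      using edge[OF that] edge[OF hex_reflect_less, of j "(x + 1) mod 6"] hex_reflect(2)[OF j that]
      by (auto simp: glue_\<phi> insert_commute)
  next
    case False
    then show ?thesis
      using cut[OF that] hex_reflect(1)[OF j that] by (auto simp: glue_\<phi>)
  qed
  have crossing: "\<phi> (glue n (i, x)) = \<phi> (glue n (i, (x + 1) mod 6))"
    if "x < 6" "(x \<in> A) \<noteq> ((x + 1) mod 6 \<in> A)" for x
    using cut[OF that] hex_reflect(1)[OF j that(1)] that by (auto simp: glue_\<phi>)
  show ?thesis
  proof (rule closer_of_fold[where \<phi> = \<phi>])
    show "\<phi> a = \<phi> b \<or> {\<phi> a, \<phi> b} \<in> edges (ortho_chain n)"
      if "{a, b} \<in> edges (ortho_chain n)" for a b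
      using that
    proof (cases rule: edge_proj_cases[where i = i])
      case 1
      then show ?thesis using that by (auto simp: \<phi>_def)
    next
      case (2 x)
      then show ?thesis using hex_edge by blast
    next
      case (3 x)
      then show ?thesis using hex_edge[of x] by (metis insert_commute)
    qed
    show "\<phi> b = a" if ab: "{a, b} \<in> edges (ortho_chain n)" and "\<phi> a = a" "\<phi> b \<noteq> b" for a b
    proof -
      have sides: "hex_proj i a \<in> A" "hex_proj i b \<notin> A"
        using that fixed in_verts by blast+
      from ab have "\<phi> a = \<phi> b"
      proof (cases rule: edge_proj_cases[where i = i])
        case 1
        then show ?thesis using sides by simp
      next
        case (2 x)
        then show ?thesis using sides crossing[of x] by (auto simp: hex_proj_glue)
      next
        case (3 x)
        then show ?thesis using sides crossing[of x] by (auto simp: hex_proj_glue)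
      qed
      then show ?thesis using that by simp
    qed
    show "\<phi> ` verts (ortho_chain n) \<subseteq> verts (ortho_chain n)"
      using glue_in_verts[OF i hex_reflect_less] by (auto simp: \<phi>_def)
    show "\<phi> w = w" using w by (simp add: \<phi>_def)
    show "\<phi> (glue n (i, x)) = glue n (i, hex_reflect j x)"
      using \<open>x \<notin> A\<close> by (simp add: glue_\<phi>)
    show "glue n (i, hex_reflect j x) \<noteq> glue n (i, x)"
      using flip[OF \<open>x < 6\<close>] \<open>x \<notin> A\<close> by (metis hex_proj_glue)
    show "walks (ortho_chain n) w (glue n (i, x)) \<noteq> {}"
      by (intro ortho_chain_connected w glue_in_verts i \<open>x < 6\<close>)
  qed
qed

section \<open>Counting the vertices on each side\<close>

definition fibre_size :: "nat \<Rightarrow> nat \<Rightarrow> nat \<Rightarrow> nat" where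
  "fibre_size n i x = (if x = 0 then 5 * i - 4 else if x = 1 then 5 * (n - i) + 1 else 1)"

text \<open>Each of the \<open>i - 1\<close> earlier and \<open>n - i\<close> later hexagons adds five vertices to the corner on which
  it hangs, one of its six being shared with its neighbour.\<close>

lemma card_hex_proj_fibre:
  assumes "i \<in> {1..n}" "x < 6"
  shows "card {w \<in> verts (ortho_chain n). hex_proj i w = x} = fibre_size n i x"
proof -
  let ?F = "{w \<in> verts (ortho_chain n). hex_proj i w = x}"
  consider "x = 0" | "x = 1" | "2 \<le> x" by linarith
  then show ?thesis
  proof cases
    case 1
    \<comment> \<open>Second coordinate 1 is missing: that corner of an earlier hexagon has been glued to the
      next one.\<close>
    have "?F = insert (i, 0) ({1..<i} \<times> {0, 2, 3, 4, 5})"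
      using assms 1 by (auto simp: verts_ortho_chain hex_proj_def split: if_splits)
    then have "card ?F = 5 * (i - 1) + 1" by (simp add: card_cartesian_product)
    also have "\<dots> = fibre_size n i x" using 1 assms by (simp add: fibre_size_def) arith
    finally show ?thesis .
  next
    case 2
    have "?F = insert (n, 1) ({i<..n} \<times> {0, 2, 3, 4, 5})"
      using assms 2 by (auto simp: verts_ortho_chain hex_proj_def split: if_splits)
    then show ?thesis using 2 assms by (simp add: fibre_size_def card_cartesian_product)
  next
    case 3
    have "?F = {(i, x)}"
      using assms 3 by (auto simp: verts_ortho_chain hex_proj_def split: if_splits)
    then show ?thesis using 3 by (simp add: fibre_size_def)
  qed
qed

lemma card_hex_proj_vimage:
  assumes "i \<in> {1..n}" "A \<subseteq> {..<6}"
  shows "card {w \<in> verts (ortho_chain n). hex_proj i w \<in> A} = (\<Sum>x\<in>A. fibre_size n i x)"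
proof -
  have fin: "finite (verts (ortho_chain n))" "finite A"
    using fin_simple_graph_ortho_chain[of n] assms finite_subset[of A "{..<6}"]
    by (auto simp: fin_simple_graph_def)
  have "{w \<in> verts (ortho_chain n). hex_proj i w \<in> A} 
      = (\<Union>x\<in>A. {w \<in> verts (ortho_chain n). hex_proj i w = x})" by auto
  also have "card \<dots> = (\<Sum>x\<in>A. card {w \<in> verts (ortho_chain n). hex_proj i w = x})"
    using fin by (intro card_UN_disjoint) auto
  also have "\<dots> = (\<Sum>x\<in>A. fibre_size n i x)"
    using assms by (intro sum.cong card_hex_proj_fibre) auto
  finally show ?thesis .
qed

lemma n_closer_hex_edge:
  assumes i: "i \<in> {1..n}" and j: "j < 6"
  shows "n_closer (ortho_chain n) (glue n (i, j)) (hex_edge n (i, j)) = 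
           (\<Sum>x\<in>hex_side j. fibre_size n i x)" (is ?near)
    and "n_closer (ortho_chain n) (glue n (i, (j + 1) mod 6)) (hex_edge n (i, j)) =
           (\<Sum>x\<in>{..<6} - hex_side j. fibre_size n i x)" (is ?far)
proof -
  let ?u = "glue n (i, j)" and ?v = "glue n (i, (j + 1) mod 6)"
  let ?V = "verts (ortho_chain n)"
  define S where "S = {w \<in> ?V. hex_proj i w \<in> hex_side j}"
  define T where "T = {w \<in> ?V. hex_proj i w \<in> {..<6} - hex_side j}"
  have T: "T = ?V - S" using hex_proj_less by (auto simp: S_def T_def)
  have j': "j \<in> hex_side j" "(j + 1) mod 6 \<notin> hex_side j" "(j + 1) mod 6 < 6"
    and refl: "hex_reflect j j = (j + 1) mod 6" "hex_reflect j ((j + 1) mod 6) = j"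
    using j by (cases rule: less_six_cases; simp add: hex_side_def hex_reflect_def)+
  have side: "hex_side j \<subseteq> {..<6}" using j by (auto simp: hex_side_def)
  have near: "distance (ortho_chain n) w ?u < distance (ortho_chain n) w ?v" if "w \<in> S" for w
    using closer_on_side[OF i j, of "(j + 1) mod 6" "hex_side j" w]
      hex_reflect_side[OF j] j' refl that by (auto simp: S_def)
  have far: "distance (ortho_chain n) w ?v < distance (ortho_chain n) w ?u" if "w \<in> T" for w
    using closer_on_side[OF i j, of j "{..<6} - hex_side j" w]
      hex_reflect_side[OF j] hex_reflect_less j j' refl that by (auto simp: T_def)
  have "?u \<noteq> ?v" using j' by (metis hex_proj_glue)
  then have "n_closer (ortho_chain n) ?u {?u, ?v} = card S"
    "n_closer (ortho_chain n) ?v {?v, ?u} = card T"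
    by (intro n_closer_eq_card; use near far T in \<open>auto simp: S_def\<close>)+
  moreover have "card S = (\<Sum>x\<in>hex_side j. fibre_size n i x)"
    "card T = (\<Sum>x\<in>{..<6} - hex_side j. fibre_size n i x)"
    unfolding S_def T_def using side by (intro card_hex_proj_vimage i; blast)+
  ultimately show ?near ?far
    by (simp_all add: hex_edge_def insert_commute)
qed


text \<open>The far side of an edge is the near side of the opposite edge.\<close>

lemma compl_hex_side:
  assumes "j < 6"
  shows "{..<6} - hex_side j = hex_side ((j + 3) mod 6)"
  using assms by (cases rule: less_six_cases) (auto simp: hex_side_def)

lemma sum_fibre_size_hex_side:
  assumes "i \<in> {1..n}" "j < 6"
  shows "real (\<Sum>x\<in>hex_side j. fibre_size n i x) =
    (if j = 0 then 5 * real i - 2 else if j = 3 then 5 * (real n - real i) + 3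
     else if j \<le> 2 then 5 * real n - 2 else 3)"
  using assms(2)
  by (cases rule: less_six_cases; use assms(1) in \<open>simp add: hex_side_def fibre_size_def of_nat_diff\<close>)

section \<open>The Graovac-Ghorbani index\<close>

lemma sum_edges_ortho_chain:
  "(\<Sum>e\<in>edges (ortho_chain n). F e) = (\<Sum>i=1..n. \<Sum>j<6. F (hex_edge n (i, j)))"
  unfolding edges_ortho_chain sum.reindex[OF inj_on_hex_edge] sum.cartesian_product
  by (simp add: split_def)

lemma glue_neq_glue_Suc: "j < 6 \<Longrightarrow> glue n (i, j) \<noteq> glue n (i, (j + 1) mod 6)"
  by (cases rule: less_six_cases) (auto simp: glue_def)

lemma sum_hex_edge:
  "j < 6 \<Longrightarrow> (\<Sum>u\<in>hex_edge n (i, j). f u) = f (glue n (i, j)) + f (glue n (i, (j + 1) mod 6))"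
  using glue_neq_glue_Suc[of j n i] by (simp add: hex_edge_def)

lemma prod_hex_edge:
  "j < 6 \<Longrightarrow> (\<Prod>u\<in>hex_edge n (i, j). f u) = f (glue n (i, j)) * f (glue n (i, (j + 1) mod 6))"
  using glue_neq_glue_Suc[of j n i] by (simp add: hex_edge_def)

lemma sum_lessThan_six: "(\<Sum>j<6. f j) = f 0 + f 1 + f 2 + f 3 + f 4 + f (5::nat)"
  by (simp add: eval_nat_numeral)

lemma ABC_GG_ortho_chain:
  "ABC_GG (ortho_chain n) =
     2 * (\<Sum>i=1..n. sqrt ((5 * real n - 1) / ((5 * real i - 2) * (5 * (real n - real i) + 3))))
     + 4 * real n * sqrt ((5 * real n - 1) / (3 * (5 * real n - 2)))"
proof -
  let ?g = "\<lambda>i. sqrt ((5 * real n - 1) / ((5 * real i - 2) * (5 * (real n - real i) + 3)))"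
  let ?h = "sqrt ((5 * real n - 1) / (3 * (5 * real n - 2)))"
  have summand: "sqrt (((\<Sum>u\<in>hex_edge n (i, j). real (n_closer (ortho_chain n) u (hex_edge n (i, j)))) - 2)
        / (\<Prod>u\<in>hex_edge n (i, j). real (n_closer (ortho_chain n) u (hex_edge n (i, j)))))
      = (if j = 0 \<or> j = 3 then ?g i else ?h)"
    if "i \<in> {1..n}" "j < 6" for i j
  proof -
    have "(j + 3) mod 6 < 6" by simp
    note far = sum_fibre_size_hex_side[OF that(1) this]
    show ?thesis
      unfolding sum_hex_edge[OF that(2)] prod_hex_edge[OF that(2)] n_closer_hex_edge[OF that]
        compl_hex_side[OF that(2)] sum_fibre_size_hex_side[OF that] far
      using that(2) by (cases rule: less_six_cases) (simp_all add: algebra_simps)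
  qed
  have "ABC_GG (ortho_chain n) = (\<Sum>i=1..n. \<Sum>j<6. if j = (0::nat) \<or> j = 3 then ?g i else ?h)"
    unfolding ABC_GG_def sum_edges_ortho_chain by (intro sum.cong refl summand) auto
  also have "\<dots> = (\<Sum>i=1..n. 2 * ?g i + 4 * ?h)"
    by (intro sum.cong refl) (simp add: sum_lessThan_six)
  also have "\<dots> = 2 * (\<Sum>i=1..n. ?g i) + 4 * real n * ?h"
    by (simp add: sum.distrib sum_distrib_left)
  finally show ?thesis .
qed

section \<open>Degrees and the atom-bond connectivity index\<close>

text \<open>Degrees are counted on the incident pairs of hexagon and position, by \<open>inj_on_hex_edge\<close>. A vertex
  that is not glued has a single representative and so two edges; a glued one has two
  representatives and so four.\<close>

lemma degree_ortho_chain: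
  assumes "i \<in> {1..n}" "j < 6"
  shows "degree (ortho_chain n) (glue n (i, j)) = (if j = 0 \<and> 1 < i \<or> j = 1 \<and> i < n then 4 else 2)"
proof -
  let ?I = "\<lambda>u. {p \<in> {1..n} \<times> {..<6}. u \<in> hex_edge n p}"
  have degree: "degree (ortho_chain n) u = card (?I u)" for u
  proof -
    have "{e \<in> edges (ortho_chain n). u \<in> e} = hex_edge n ` ?I u"
      by (auto simp: edges_ortho_chain)
    then show ?thesis
      using card_image[of "hex_edge n" "?I u"] inj_on_subset[OF inj_on_hex_edge]
      by (auto simp: degree_def)
  qed
  have joint: "degree (ortho_chain n) (i, 0) = 4" if "1 < i" "i \<le> n" for i
  proof -
    have glued: "(i, 0) = glue n (a, b) \<longleftrightarrow> a = i \<and> b = 0 \<or> a = i - 1 \<and> b = 1" for a b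
      using that by (auto simp: glue_def)
    have "(b + 1) mod 6 = 0 \<longleftrightarrow> b = 5" "(b + 1) mod 6 = 1 \<longleftrightarrow> b = 0" if "b < 6" for b :: nat
      using that by (cases rule: less_six_cases; simp)+
    then have "?I (i, 0) = {(i, 0), (i, 5), (i - 1, 0), (i - 1, 1)}"
      using that by (auto simp: hex_edge_def glued)
    then show ?thesis using that by (simp add: degree)
  qed
  have inner: "?I (glue n (i, j)) = {(i, j), (i, (j + 5) mod 6)}"
    if "\<not> (j = 0 \<and> 1 < i \<or> j = 1 \<and> i < n)"
  proof -
    have unglued: "glue n (i, j) = glue n (a, b) \<longleftrightarrow> a = i \<and> b = j" if "a \<noteq> 0" for a b
      using that \<open>\<not> (j = 0 \<and> 1 < i \<or> j = 1 \<and> i < n)\<close> by (auto simp: glue_def)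
    have "(b + 1) mod 6 = j \<longleftrightarrow> b = (j + 5) mod 6" if "b < 6" for b
      using assms(2)
      by (cases rule: less_six_cases; use that in \<open>cases rule: less_six_cases; simp\<close>)
    then show ?thesis
      using assms by (auto simp: hex_edge_def unglued)
  qed
  show ?thesis
  proof (cases "j = 0 \<and> 1 < i \<or> j = 1 \<and> i < n")
    case True
    then show ?thesis using joint[of i] joint[of "i + 1"] assms by (auto simp: glue_def)
  next
    case False
    have "(j + 5) mod 6 \<noteq> j"
      using assms(2) by (cases rule: less_six_cases) auto
    then show ?thesis using inner[OF False] False by (simp add: degree)
  qed
qed

text \<open>The two kinds of summand arise from \<open>(2 + 2 - 2) / (2 * 2) = (2 + 4 - 2) / (2 * 4) = 1 / 2\<close> and
  \<open>(4 + 4 - 2) / (4 * 4) = 3 / 8\<close>. The latter occurs for the edge between the two contact vertices of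
  each hexagon other than the first and the last.\<close>

lemma ABC_ortho_chain:
  assumes "n \<ge> 2"
  shows "ABC (ortho_chain n) = (5 * real n + 2) / sqrt 2 + (real n - 2) * sqrt 6 / 4"
proof -
  have half: "sqrt (1 / 2) = 1 / sqrt 2" by (simp add: real_sqrt_divide)
  have "sqrt (6 / 16) = sqrt 6 / sqrt (4\<^sup>2)" by (simp only: real_sqrt_divide) simp
  then have three_eighths: "sqrt (3 / 8) = sqrt 6 / 4" by simp
  let ?d = "\<lambda>u. real (degree (ortho_chain n) u)"
  have summand: "sqrt (((\<Sum>u\<in>hex_edge n (i, j). ?d u) - 2) / (\<Prod>u\<in>hex_edge n (i, j). ?d u))
      = (if j = 0 \<and> i \<in> {2..n-1} then sqrt 6 / 4 else 1 / sqrt 2)"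
    if "i \<in> {1..n}" "j < 6" for i j
  proof -
    have "(j + 1) mod 6 < 6" by simp
    note next_degree = degree_ortho_chain[OF that(1) this]
    show ?thesis
      unfolding sum_hex_edge[OF that(2)] prod_hex_edge[OF that(2)] degree_ortho_chain[OF that]
        next_degree
      using that(2) by (cases rule: less_six_cases) (use that(1) half three_eighths in auto)
  qed
  have "ABC (ortho_chain n) =
      (\<Sum>i=1..n. \<Sum>j<6. if j = (0::nat) \<and> i \<in> {2..n-1} then sqrt 6 / 4 else 1 / sqrt 2)"
    unfolding ABC_def sum_edges_ortho_chain by (intro sum.cong refl summand) auto
  also have "\<dots> = (\<Sum>i=1..n. 6 / sqrt 2 + (if i \<in> {2..n-1} then sqrt 6 / 4 - 1 / sqrt 2 else 0))"
    by (intro sum.cong refl) (simp add: sum_lessThan_six)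
  also have "\<dots> = real n * (6 / sqrt 2) + (\<Sum>i\<in>{1..n} \<inter> {2..n-1}. sqrt 6 / 4 - 1 / sqrt 2)"
    unfolding sum.distrib sum.inter_restrict[OF finite_atLeastAtMost] by simp
  also have "{1..n} \<inter> {2..n-1} = {2..n-1}" by auto
  also have "real n * (6 / sqrt 2) + (\<Sum>i\<in>{2..n-1}. sqrt 6 / 4 - 1 / sqrt 2)
      = (5 * real n + 2) / sqrt 2 + (real n - 2) * sqrt 6 / 4"
  proof -
    have "real n * (6 / r) + (real n - 2) * (s / 4 - 1 / r) = (5 * real n + 2) / r + (real n - 2) * s / 4"
      if "r \<noteq> 0" for r s :: real
      using that by (simp add: field_simps)
    from this[of "sqrt 2" "sqrt 6"] show ?thesis
      using assms by (simp add: of_nat_diff)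
  qed
  finally show ?thesis .
qed

section \<open>Closed forms by parity\<close>

lemma sum_symmetric_tail:
  fixes g :: "nat \<Rightarrow> real"
  assumes "\<And>i. i \<in> {1..k} \<Longrightarrow> g (n + 1 - i) = g i" "k \<le> n"
  shows "(\<Sum>i=n-k+1..n. g i) = (\<Sum>i=1..k. g i)"
proof (rule sum.reindex_bij_witness[of _ "\<lambda>i. n + 1 - i" "\<lambda>i. n + 1 - i"])
  fix a assume "a \<in> {n-k+1..n}"
  then have "n + 1 - a \<in> {1..k}" and a: "n + 1 - (n + 1 - a) = a"
    using assms(2) by auto
  from assms(1)[OF this(1)] show "g (n + 1 - a) = g a"
    unfolding a by (rule sym)
qed (use assms(2) in auto)

lemma sum_symmetric_even:
  fixes g :: "nat \<Rightarrow> real"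
  assumes "\<And>i. i \<in> {1..k} \<Longrightarrow> g (2 * k + 1 - i) = g i"
  shows "(\<Sum>i=1..2*k. g i) = 2 * (\<Sum>i=1..k. g i)"
proof -
  have "(\<Sum>i=1..2*k. g i) = (\<Sum>i=1..k. g i) + (\<Sum>i=k+1..2*k. g i)"
    using sum.ub_add_nat[of 1 k g k] by (simp add: mult_2)
  also have "(\<Sum>i=k+1..2*k. g i) = (\<Sum>i=1..k. g i)"
    using sum_symmetric_tail[of k g "2 * k", OF assms] by (simp add: mult_2)
  finally show ?thesis by simp
qed

lemma sum_symmetric_odd:
  fixes g :: "nat \<Rightarrow> real"
  assumes "\<And>i. i \<in> {1..k} \<Longrightarrow> g (2 * k + 2 - i) = g i"
  shows "(\<Sum>i=1..2*k+1. g i) = 2 * (\<Sum>i=1..k. g i) + g (k + 1)"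
proof -
  have "(\<Sum>i=1..2*k+1. g i) = (\<Sum>i=1..k+1. g i) + (\<Sum>i=k+2..2*k+1. g i)"
    using sum.ub_add_nat[of 1 "k + 1" g k] by (simp add: mult_2)
  also have "(\<Sum>i=k+2..2*k+1. g i) = (\<Sum>i=1..k. g i)"
    using sum_symmetric_tail[of k g "2 * k + 1"] assms by (simp add: mult_2)
  finally show ?thesis by simp
qed

theorem theorem3p6:
  fixes n :: nat
  assumes "n \<ge> 2"
  shows "(\<forall>k::nat. k \<ge> 1 \<longrightarrow>
       (n = 2 * k \<longrightarrow>
          ABC_GG (ortho_chain n) =
            4 * (\<Sum>i=1..k. sqrt ((10 * real k - 1) /
                   ((10 * real k - 5 * real i + 3) * (5 * real i - 2))))
            + 8 * real k * sqrt ((10 * real k - 1) / (30 * real k - 6))) \<and>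
       (n = 2 * k + 1 \<longrightarrow>
          ABC_GG (ortho_chain n) =
            4 * (\<Sum>i=1..k. sqrt ((10 * real k + 4) /
                   ((10 * real k - 5 * real i + 8) * (5 * real i - 2))))
            + (8 * real k + 4) * sqrt ((10 * real k + 4) / (30 * real k + 9))
            + 2 * sqrt (10 * real k + 4) / (5 * real k + 3)))
     \<and> ABC (ortho_chain n) = (5 * real n + 2) / sqrt 2 + (real n - 2) * sqrt 6 / 4"
proof (intro conjI allI impI)
  fix k :: nat
  define g where
    "g i = sqrt ((5 * real n - 1) / ((5 * real i - 2) * (5 * (real n - real i) + 3)))" for i
  have symmetric: "g (n + 1 - i) = g i" if "i \<in> {1..n}" for i
    using that by (simp add: g_def of_nat_diff algebra_simps)
  note formula = ABC_GG_ortho_chain[of n, folded g_def]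
  {
    assume n: "n = 2 * k"
    have "(\<Sum>i=1..n. g i) = 2 * (\<Sum>i=1..k. g i)"
      using sum_symmetric_even[of k g] symmetric by (simp add: n)
    moreover have "g i = sqrt ((10 * real k - 1) / ((10 * real k - 5 * real i + 3) * (5 * real i - 2)))"
      for i by (simp add: g_def n mult.commute algebra_simps)
    moreover have "3 * (5 * real n - 2) = 30 * real k - 6" by (simp add: n)
    ultimately show "ABC_GG (ortho_chain n) =
            4 * (\<Sum>i=1..k. sqrt ((10 * real k - 1) /
                   ((10 * real k - 5 * real i + 3) * (5 * real i - 2))))
            + 8 * real k * sqrt ((10 * real k - 1) / (30 * real k - 6))"
      unfolding formula by (simp add: n)
  next
    assume n: "n = 2 * k + 1"
    have "(\<Sum>i=1..n. g i) = 2 * (\<Sum>i=1..k. g i) + g (k + 1)"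
      using sum_symmetric_odd[of k g] symmetric by (simp add: n)
    moreover have "g (k + 1) = sqrt ((10 * real k + 4) / (5 * real k + 3)\<^sup>2)"
      by (simp add: g_def n power2_eq_square algebra_simps)
    then have "g (k + 1) = sqrt (10 * real k + 4) / (5 * real k + 3)"
      by (simp add: real_sqrt_divide)
    moreover have "g i = sqrt ((10 * real k + 4) / ((10 * real k - 5 * real i + 8) * (5 * real i - 2)))"
      for i by (simp add: g_def n algebra_simps)
    moreover have "4 * real n * sqrt ((5 * real n - 1) / (3 * (5 * real n - 2))) =
        (8 * real k + 4) * sqrt ((10 * real k + 4) / (30 * real k + 9))"
      by (simp add: n algebra_simps)
    ultimately show "ABC_GG (ortho_chain n) =
            4 * (\<Sum>i=1..k. sqrt ((10 * real k + 4) /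
                   ((10 * real k - 5 * real i + 8) * (5 * real i - 2))))
            + (8 * real k + 4) * sqrt ((10 * real k + 4) / (30 * real k + 9))
            + 2 * sqrt (10 * real k + 4) / (5 * real k + 3)"
      unfolding formula by (simp only: distrib_left) simp
  }
next
  show "ABC (ortho_chain n) = (5 * real n + 2) / sqrt 2 + (real n - 2) * sqrt 6 / 4"
    using assms by (rule ABC_ortho_chain)
qed

end
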